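(* Let $A\in\mathbb{R}^{n\times n}$, $B\in\mathbb{R}^{n\times m}$, $C\in\mathbb{R}^{p\times n}$ and consider the system $x_{t+1}=Ax_t+Bu_t$, $y_t=Cx_t$. Assume that $(A,B)$ is controllable and that $(A,C)$ and $(A,Q_x^{1/2})$ are observable, where $Q_x=C^\top QC$. With the objects defined in the context (built from a user-defined Luenberger observer gain $L\in\mathbb{R}^{n\times p}$), the following assertions hold. (a) The state $x_t$ can be expressed in terms of the input-output filter vector $\eta_t\in\mathbb{R}^{(m+p+1)n}$ as $$x_t=[S_u,S_y,S_\epsilon]\,[(\eta_t^u)^\top,(\eta_t^y)^\top,(\eta_t^\epsilon)^\top]^\top=:S\eta_t,$$ where $\eta_t^u:=[(\eta_t^{u^1})^\top,\dots,(\eta_t^{u^m})^\top]^\top$, $\eta_t^y:=[(\eta_t^{y^1})^\top,\dots,(\eta_t^{y^p})^\top]^\top$, and $\eta_t^\epsilon\in\mathbb{R}^n$ satisfies $\eta_{t+1}^\epsilon=A_\epsilon\eta_t^\epsilon$, $\eta_0^\epsilon\neq\mathbf 0$. The substitute state $\eta_t$ can be generated in a model-free manner via the user-defined system $$\eta_{t+1}=\mathcal{A}_s\eta_t+\mathcal{B}_s\,[u_t^\top,\;y_t^\top,\;0]^\top,\qquad \eta_0=[\mathbf 0_{1\times(m+p)n},(\eta_0^\epsilon)^\top]^\top\neq\mathbf 0 .$$ (b) The parameterization matrix $S\in\mathbb{R}^{n\times(m+p+1)n}$ has full row rank.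
   Context: Here $x_t\in\mathbb{R}^n$, $u_t\in\mathbb{R}^m$, $y_t\in\mathbb{R}^p$, $p\le n$, $C$ has full row rank, and $Q\in\mathbb{R}^{p\times p}$ is symmetric positive semidefinite. $\otimes$ is the Kronecker product, and $\operatorname{diag}(\cdot,\cdot)$ is the block diagonal matrix. The Luenberger observer is $x^c_{t+1}=(A-LC)x^c_t+Bu_t+Ly_t$, with observation error $\epsilon_t:=x_t-x_t^c$. Write $\Lambda(z):=\det(zI_n-(A-LC))=z^n+a_{n-1}z^{n-1}+\dots+a_1z+a_0$, $a_n:=1$, and $\operatorname{adj}(zI_n-(A-LC))=D_{n-1}z^{n-1}+\dots+D_1z+D_0$; equivalently $D_i=\sum_{j=1}^{n-i}a_{n-j+1}(A-LC)^{n-i-j}$. Put $\mathcal{D}:=[D_0,\dots,D_{n-1}]\in\mathbb{R}^{n\times n^2}$. Let $A_\epsilon\in\mathbb{R}^{n\times n}$ be a user-defined matrix with the same eigenvalues as $A-LC$, and define $\mathcal{D}^\epsilon$ in the same way as $\mathcal{D}$ with $A-LC$ replaced by $A_\epsilon$. The user-chosen vector $\eta_0^\epsilon\neq\mathbf 0$ is such that $S_{\epsilon_\eta}:=\mathcal{D}^\epsilon(I_n\otimes\eta_0^\epsilon)$ is invertible. $A_s\in\mathbb{R}^{n\times n}$ is the companion matrix with ones on the superdiagonal, last row $(-a_0,-a_1,\dots,-a_{n-1})$ and zeros elsewhere; $b_s:=(0,\dots,0,1)^\top\in\mathbb{R}^n$; $\mathcal{A}_s:=\operatorname{diag}(I_{m+p}\otimes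 A_s,A_\epsilon)$; $\mathcal{B}_s:=\operatorname{diag}(I_{m+p}\otimes b_s,\mathbf 0_{n\times1})$. Let $u_t^i$ and $y_t^j$ be the $i$-th and $j$-th components of $u_t$ and $y_t$, with z-transforms $U^i(z)$ and $Y^j(z)$. Then $\eta_t^{u^i}$ is the inverse z-transform of $\left[\frac{U^i(z)}{\Lambda(z)},\frac{zU^i(z)}{\Lambda(z)},\dots,\frac{z^{n-1}U^i(z)}{\Lambda(z)}\right]^\top$ and $\eta_t^{y^j}$ that of $\left[\frac{Y^j(z)}{\Lambda(z)},\dots,\frac{z^{n-1}Y^j(z)}{\Lambda(z)}\right]^\top$; they satisfy $\eta_{t+1}^{u^i}=A_s\eta_t^{u^i}+b_su_t^i$, $\eta_0^{u^i}=\mathbf 0$, and $\eta_{t+1}^{y^j}=A_s\eta_t^{y^j}+b_sy_t^j$, $\eta_0^{y^j}=\mathbf 0$. With $B_i$ and $L_j$ the $i$-th column of $B$ and the $j$-th column of $L$: $S_u:=[\mathcal{D}(I_n\otimes B_1),\dots,\mathcal{D}(I_n\otimes B_m)]$, $S_y:=[\mathcal{D}(I_n\otimes L_1),\dots,\mathcal{D}(I_n\otimes L_p)]$, $S_{\epsilon_x}:=\mathcal{D}(I_n\otimes\epsilon_0)$, $S_\epsilon:=S_{\epsilon_x}S_{\epsilon_\eta}^{-1}$.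
   Formalization: The observer is assumed to start at x^c_0 = 0 (so ε_0 = x_0), without which (a) already fails at t = 0 since Sη_0 = ε_0; "same eigenvalues" is read as complex eigenvalues with algebraic multiplicity. *)

theory Defs
  imports
    "Jordan_Normal_Form.Char_Poly"
    "Jordan_Normal_Form.DL_Rank"
    "Jordan_Normal_Form.Gauss_Jordan_Elimination"
    "HOL-Computational_Algebra.Computational_Algebra"
begin

definition append_cols :: "'a :: zero mat \<Rightarrow> 'a mat \<Rightarrow> 'a mat" where
  "append_cols X Y = four_block_mat X Y (0\<^sub>m 0 (dim_col X)) (0\<^sub>m 0 (dim_col Y))"

text \<open>The row count \<open>n\<close> is an argument because it cannot be read off an empty list.\<close>

definition hconcat :: "nat \<Rightarrow> 'a :: zero mat list \<Rightarrow> 'a mat" where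
  "hconcat n Xs = foldr append_cols Xs (0\<^sub>m n 0)"

definition vconcat :: "'a :: zero vec list \<Rightarrow> 'a vec" where
  "vconcat vs = foldr append_vec vs (0\<^sub>v 0)"

definition col_mat :: "'a vec \<Rightarrow> 'a mat" where
  "col_mat v = mat_of_cols (dim_vec v) [v]"

definition kron :: "'a :: times mat \<Rightarrow> 'a mat \<Rightarrow> 'a mat" where
  "kron X Y = mat (dim_row X * dim_row Y) (dim_col X * dim_col Y)
     (\<lambda>(i, j). X $$ (i div dim_row Y, j div dim_col Y) * Y $$ (i mod dim_row Y, j mod dim_col Y))"

definition full_row_rank :: "real mat \<Rightarrow> bool" where
  "full_row_rank X \<longleftrightarrow> vec_space.rank (dim_row X) X = dim_row X"

definition sym_psd :: "real mat \<Rightarrow> bool" where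
  "sym_psd X \<longleftrightarrow> square_mat X \<and> transpose_mat X = X \<and>
     (\<forall>v \<in> carrier_vec (dim_row X). 0 \<le> v \<bullet> (X *\<^sub>v v))"

definition psd_sqrt_of :: "real mat \<Rightarrow> real mat \<Rightarrow> bool" where
  "psd_sqrt_of R X \<longleftrightarrow> sym_psd R \<and> R * R = X"

text \<open>The complex eigenvalues of a real matrix, with algebraic multiplicity.\<close>

definition eigvals :: "real mat \<Rightarrow> complex multiset" where
  "eigvals X = proots (char_poly (map_mat complex_of_real X))"

primrec lti_state :: "real mat \<Rightarrow> real mat \<Rightarrow> (nat \<Rightarrow> real vec) \<Rightarrow> real vec \<Rightarrow> nat \<Rightarrow> real vec" where
  "lti_state A B u x0 0 = x0"
| "lti_state A B u x0 (Suc t) = A *\<^sub>v lti_state A B u x0 t + B *\<^sub>v u t"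

definition controllable :: "real mat \<Rightarrow> real mat \<Rightarrow> bool" where
  "controllable A B \<longleftrightarrow>
     (\<forall>x0 \<in> carrier_vec (dim_row A). \<forall>x1 \<in> carrier_vec (dim_row A).
        \<exists>u T. (\<forall>t. u t \<in> carrier_vec (dim_col B)) \<and> lti_state A B u x0 T = x1)"

definition observable :: "real mat \<Rightarrow> real mat \<Rightarrow> bool" where
  "observable A C \<longleftrightarrow>
     (\<forall>x0 \<in> carrier_vec (dim_row A). \<forall>x1 \<in> carrier_vec (dim_row A).
        (\<forall>t. C *\<^sub>v (A ^\<^sub>m t *\<^sub>v x0) = C *\<^sub>v (A ^\<^sub>m t *\<^sub>v x1)) \<longrightarrow> x0 = x1)"

text \<open>\<^term>\<open>char_poly_matrix M\<close> is $zI - M$ over \<^typ>\<open>real poly\<close>, so this is the coefficient of $z^i$ in its adjugate.\<close>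

definition adj_coeff :: "real mat \<Rightarrow> nat \<Rightarrow> real mat" where
  "adj_coeff M i = map_mat (\<lambda>q. coeff q i) (adj_mat (char_poly_matrix M))"

definition adj_row :: "real mat \<Rightarrow> real mat" where
  "adj_row M = hconcat (dim_row M) (map (adj_coeff M) [0..<dim_row M])"

definition par_vec :: "real mat \<Rightarrow> real vec \<Rightarrow> real mat" where
  "par_vec M v = adj_row M * kron (1\<^sub>m (dim_row M)) (col_mat v)"

definition par_mat :: "real mat \<Rightarrow> real mat \<Rightarrow> real mat" where
  "par_mat M X = hconcat (dim_row M) (map (\<lambda>j. par_vec M (col X j)) [0..<dim_col X])"

definition companion :: "real poly \<Rightarrow> real mat" where
  "companion q = mat (degree q) (degree q)
     (\<lambda>(i, j). if i = degree q - 1 then - coeff q j else if j = i + 1 then 1 else 0)"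

text \<open>
  The one-sided z-transform $\sum_{t \ge 0} f_t z^{-t}$ is taken as a formal Laurent series in
  $z^{-1}$, so the series variable \<^const>\<open>fls_X\<close> stands for $z^{-1}$ and \<^const>\<open>fls_X_inv\<close> for $z$.
  No growth condition on the sequence is needed.
\<close>

definition ztrans :: "(nat \<Rightarrow> real) \<Rightarrow> real fls" where
  "ztrans f = fps_to_fls (Abs_fps f)"

definition inv_ztrans :: "real fls \<Rightarrow> nat \<Rightarrow> real" where
  "inv_ztrans F t = fls_nth F (int t)"

definition zpoly :: "real poly \<Rightarrow> real fls" where
  "zpoly q = poly (map_poly fls_const q) fls_X_inv"

definition io_filter :: "real poly \<Rightarrow> (nat \<Rightarrow> real) \<Rightarrow> nat \<Rightarrow> real vec" where
  "io_filter q f t =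
     vec (degree q) (\<lambda>k. inv_ztrans (fls_X_inv ^ k * ztrans f / zpoly q) t)"

definition io_filters :: "real poly \<Rightarrow> nat \<Rightarrow> (nat \<Rightarrow> real vec) \<Rightarrow> nat \<Rightarrow> real vec" where
  "io_filters q k w t = vconcat (map (\<lambda>i. io_filter q (\<lambda>s. w s $ i) t) [0..<k])"

end

theory Submission
  imports Defs
begin

text \<open>
  Write $M = A - LC$ and $P_v = [D_0 v, \dots, D_{n-1} v]$. Comparing coefficients in
  $(zI - M) \operatorname{adj}(zI - M) = \Lambda(z) I$ gives $D_{k-1} = M D_k + a_k I$ and
  $D_{n-1} = I$, that is, $P_v A_s = M P_v$ and $P_v b_s = v$. Hence $P_v$ intertwines the
  companion-form filters with the dynamics of $M$: summing over the columns of $B$ and $L$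
  reproduces the observer state, while the error satisfies $\epsilon_t = P_{\epsilon_0} A_s^t b_s$.
  The user-chosen error system has the same companion matrix, so
  $\eta^\epsilon_t = S_{\epsilon_\eta} A_s^t b_s$, and inverting $S_{\epsilon_\eta}$ yields
  $\epsilon_t = S_\epsilon \eta^\epsilon_t$.

  For the rank, a trajectory of the system starting at $0$ coincides with its observer state, so
  it lies in the range of $[S_u, S_y]$; by controllability such trajectories reach every vector.
\<close>

no_notation fps_nth (infixl \<open>$\<close> 75)
no_notation fls_nth (infixl \<open>$$\<close> 75)

section \<open>Block rows of matrices and stacked vectors\<close>

lemma append_cols_carrier:
  "X \<in> carrier_mat n a \<Longrightarrow> Y \<in> carrier_mat n b \<Longrightarrow> append_cols X Y \<in> carrier_mat n (a + b)"
  unfolding append_cols_def carrier_mat_def by auto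

lemma append_cols_mult_append_vec:
  fixes X Y :: "'a :: comm_ring_1 mat"
  assumes "X \<in> carrier_mat n a" "Y \<in> carrier_mat n b" "v \<in> carrier_vec a" "w \<in> carrier_vec b"
  shows "append_cols X Y *\<^sub>v (v @\<^sub>v w) = X *\<^sub>v v + Y *\<^sub>v w"
proof -
  have "append_cols X Y *\<^sub>v (v @\<^sub>v w) =
      (X *\<^sub>v v + Y *\<^sub>v w) @\<^sub>v (0\<^sub>m 0 a *\<^sub>v v + 0\<^sub>m 0 b *\<^sub>v w)"
    unfolding append_cols_def carrier_matD(2)[OF assms(1)] carrier_matD(2)[OF assms(2)] using assms
    by (intro four_block_mat_mult_vec[of _ n a _ b _ 0]) auto
  also have "\<dots> = X *\<^sub>v v + Y *\<^sub>v w"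
    using assms by (intro eq_vecI) auto
  finally show ?thesis .
qed

lemma hconcat_Nil [simp]: "hconcat n [] = 0\<^sub>m n 0"
  and hconcat_Cons [simp]: "hconcat n (X # Xs) = append_cols X (hconcat n Xs)"
  by (simp_all add: hconcat_def)

lemma vconcat_Nil [simp]: "vconcat [] = 0\<^sub>v 0"
  and vconcat_Cons [simp]: "vconcat (v # vs) = v @\<^sub>v vconcat vs"
  by (simp_all add: vconcat_def)

lemma hconcat_carrier:
  assumes "\<And>X. X \<in> set Xs \<Longrightarrow> X \<in> carrier_mat n a"
  shows "hconcat n Xs \<in> carrier_mat n (length Xs * a)"
  using assms
proof (induction Xs)
  case (Cons X Xs)
  then have "append_cols X (hconcat n Xs) \<in> carrier_mat n (a + length Xs * a)"
    by (intro append_cols_carrier) auto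
  then show ?case by simp
qed simp

lemma vconcat_carrier:
  assumes "\<And>v. v \<in> set vs \<Longrightarrow> v \<in> carrier_vec a"
  shows "vconcat vs \<in> carrier_vec (length vs * a)"
  using assms
proof (induction vs)
  case (Cons v vs)
  then have "v @\<^sub>v vconcat vs \<in> carrier_vec (a + length vs * a)"
    by (intro append_carrier_vec) auto
  then show ?case by simp
qed simp

lemma append_vec_assoc: "(u @\<^sub>v v) @\<^sub>v w = u @\<^sub>v v @\<^sub>v w"
  by (intro eq_vecI) (auto simp: ac_simps)

lemma append_vec_vNil_right [simp]: "v @\<^sub>v vNil = v"
  by (intro eq_vecI) auto

lemma vconcat_append: "vconcat (vs @ ws) = vconcat vs @\<^sub>v vconcat ws"
  by (induction vs) (auto simp: append_vec_assoc)

lemma vconcat_zero: "vconcat (map (\<lambda>_. 0\<^sub>v a) xs) = 0\<^sub>v (length xs * a)"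
proof (induction xs)
  case (Cons x xs)
  have "0\<^sub>v a @\<^sub>v 0\<^sub>v (length xs * a) = 0\<^sub>v (a + length xs * a)"
    by (intro eq_vecI) auto
  with Cons show ?case by simp
qed simp

lemma vconcat_add:
  fixes f g :: "'b \<Rightarrow> 'a :: comm_ring_1 vec"
  assumes "\<And>x. x \<in> set xs \<Longrightarrow> f x \<in> carrier_vec a \<and> g x \<in> carrier_vec a"
  shows "vconcat (map (\<lambda>x. f x + g x) xs) = vconcat (map f xs) + vconcat (map g xs)"
  using assms
proof (induction xs)
  case (Cons x xs)
  have "vconcat (map f xs) \<in> carrier_vec (length xs * a)"
       "vconcat (map g xs) \<in> carrier_vec (length xs * a)"
    using vconcat_carrier[of "map f xs" a] vconcat_carrier[of "map g xs" a] Cons.prems by auto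
  then have "(f x @\<^sub>v vconcat (map f xs)) + (g x @\<^sub>v vconcat (map g xs)) =
      (f x + g x) @\<^sub>v (vconcat (map f xs) + vconcat (map g xs))"
    using Cons.prems by (intro append_vec_add[of _ a _ _ "length xs * a"]) auto
  with Cons show ?case by simp
qed auto

text \<open>Views an ordinary vector as a stack of blocks of length one, the shape in which a factor
  I (x) b can act on it blockwise.\<close>

lemma vconcat_singletons: "vconcat (map (\<lambda>i. vec 1 (\<lambda>_. f i)) [0..<k]) = vec k f"
  by (induction k) (auto simp: vconcat_append intro!: eq_vecI split: if_splits simp: less_Suc_eq)

section \<open>Kronecker products with an identity on the left\<close>

lemma kron_carrier:
  "X \<in> carrier_mat a b \<Longrightarrow> Y \<in> carrier_mat c d \<Longrightarrow> kron X Y \<in> carrier_mat (a * c) (b * d)"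
  unfolding kron_def carrier_mat_def by auto

text \<open>Peeling off the first diagonal block turns statements about I (x) X into inductions on
  the number of blocks, and confines the div/mod index arithmetic to this one proof.\<close>

lemma kron_one_Suc:
  fixes X :: "'a :: comm_ring_1 mat"
  assumes X: "X \<in> carrier_mat r c"
  shows "kron (1\<^sub>m (Suc k)) X =
    four_block_mat X (0\<^sub>m r (k * c)) (0\<^sub>m (k * r) c) (kron (1\<^sub>m k) X)" (is "?l = ?r")
proof (rule eq_matI)
  fix i j assume ij: "i < dim_row ?r" "j < dim_col ?r"
  have K: "kron (1\<^sub>m k) X \<in> carrier_mat (k * r) (k * c)"
    by (rule kron_carrier[OF _ X]) auto
  have i: "i < r + k * r" and j: "j < c + k * c"
    using ij X K by auto
  \<comment> \<open>The mere existence of the indices i and j excludes empty blocks, so no division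
    by zero occurs in the entries of \<open>kron\<close>.\<close>
  have r: "r > 0" and c: "c > 0"
    using i j by (auto intro: Nat.gr0I)
  have di: "i div r < Suc k" and dj: "j div c < Suc k"
    using i j by (auto intro!: less_mult_imp_div_less)
  have mi: "i mod r < r" and mj: "j mod c < c"
    using r c by auto
  have ik: "(i - r) div r < k" "i - r < k * r" if "r \<le> i"
    using that i by (auto intro!: less_mult_imp_div_less)
  have jk: "(j - c) div c < k" "j - c < k * c" if "c \<le> j"
    using that j by (auto intro!: less_mult_imp_div_less)
  show "?l $$ (i, j) = ?r $$ (i, j)"
    using X K i j r c di dj ik jk mi mj
    by (cases "i < r"; cases "j < c") (auto simp: kron_def le_div_geq le_mod_geq not_less)
qed (use X in \<open>auto simp: kron_def\<close>)

lemma kron_one_mult_vconcat: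
  fixes X :: "'a :: comm_ring_1 mat"
  assumes X: "X \<in> carrier_mat r c" and "\<And>v. v \<in> set vs \<Longrightarrow> v \<in> carrier_vec c"
  shows "kron (1\<^sub>m (length vs)) X *\<^sub>v vconcat vs = vconcat (map ((*\<^sub>v) X) vs)"
  using assms(2)
proof (induction vs)
  case Nil
  show ?case by (intro eq_vecI) (auto simp: kron_def)
next
  case (Cons v vs)
  have K: "kron (1\<^sub>m (length vs)) X \<in> carrier_mat (length vs * r) (length vs * c)"
    by (rule kron_carrier[OF _ X]) auto
  have V: "vconcat vs \<in> carrier_vec (length vs * c)"
    by (rule vconcat_carrier) (use Cons.prems in auto)
  have v: "v \<in> carrier_vec c" using Cons.prems by auto
  have "kron (1\<^sub>m (length (v # vs))) X *\<^sub>v vconcat (v # vs) =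
      (X *\<^sub>v v + 0\<^sub>m r (length vs * c) *\<^sub>v vconcat vs) @\<^sub>v
      (0\<^sub>m (length vs * r) c *\<^sub>v v + kron (1\<^sub>m (length vs)) X *\<^sub>v vconcat vs)"
    using X K V v unfolding list.size(4) add_Suc_right add_0_right kron_one_Suc[OF X] vconcat_Cons
    by (intro four_block_mat_mult_vec) auto
  also have "\<dots> = X *\<^sub>v v @\<^sub>v kron (1\<^sub>m (length vs)) X *\<^sub>v vconcat vs"
    using X K V v by auto
  finally show ?case using Cons by simp
qed

text \<open>With w cut into blocks of length one, the i-th diagonal block is the single column b and
  scales by the i-th entry of w.\<close>

lemma kron_one_col_mat_mult:
  fixes b w :: "'a :: comm_ring_1 vec"
  assumes w: "w \<in> carrier_vec k"
  shows "kron (1\<^sub>m k) (col_mat b) *\<^sub>v w = vconcat (map (\<lambda>i. w $ i \<cdot>\<^sub>v b) [0..<k])"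
proof -
  let ?ws = "map (\<lambda>i. vec 1 (\<lambda>_. w $ i)) [0..<k]"
  have ws: "vconcat ?ws = w"
    unfolding vconcat_singletons using w by (intro eq_vecI) auto
  have b: "col_mat b *\<^sub>v vec 1 (\<lambda>_. a) = a \<cdot>\<^sub>v b" for a
    by (intro eq_vecI) (auto simp: col_mat_def mat_of_cols_def scalar_prod_def row_def)
  have "kron (1\<^sub>m (length ?ws)) (col_mat b) *\<^sub>v vconcat ?ws = vconcat (map ((*\<^sub>v) (col_mat b)) ?ws)"
    by (rule kron_one_mult_vconcat[where r = "dim_vec b" and c = 1])
      (auto simp: col_mat_def mat_of_cols_def)
  then show ?thesis
    unfolding ws by (simp add: b comp_def del: One_nat_def)
qed

text \<open>Working with one entry r keeps the sum over the blocks among scalars, where sums can be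
  exchanged and reindexed without tracking dimensions.\<close>

lemma hconcat_mult_vconcat_index:
  fixes F :: "'b \<Rightarrow> 'a :: comm_ring_1 mat"
  assumes "\<And>x. x \<in> set xs \<Longrightarrow> F x \<in> carrier_mat n a \<and> g x \<in> carrier_vec a" and r: "r < n"
  shows "(hconcat n (map F xs) *\<^sub>v vconcat (map g xs)) $ r = (\<Sum>x\<leftarrow>xs. (F x *\<^sub>v g x) $ r)"
  using assms(1)
proof (induction xs)
  case Nil
  show ?case using r by simp
next
  case (Cons x xs)
  have H: "hconcat n (map F xs) \<in> carrier_mat n (length xs * a)"
    using hconcat_carrier[of "map F xs" n a] Cons.prems by auto
  have V: "vconcat (map g xs) \<in> carrier_vec (length xs * a)"
    using vconcat_carrier[of "map g xs" a] Cons.prems by auto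
  have "hconcat n (map F (x # xs)) *\<^sub>v vconcat (map g (x # xs)) =
      F x *\<^sub>v g x + hconcat n (map F xs) *\<^sub>v vconcat (map g xs)"
    using append_cols_mult_append_vec[OF _ H _ V, of "F x" a "g x"] Cons.prems by simp
  then show ?case using Cons H r by simp
qed

section \<open>Surjectivity and rank; eigenvalues and the characteristic polynomial\<close>

lemma full_row_rankI:
  assumes X: "X \<in> carrier_mat n k"
    and surj: "\<And>v. v \<in> carrier_vec n \<Longrightarrow> \<exists>w \<in> carrier_vec k. X *\<^sub>v w = v"
  shows "full_row_rank X"
proof -
  interpret vec_space "TYPE(real)" n .
  have c: "set (cols X) \<subseteq> carrier_vec n"
    using X cols_dim by blast
  have "carrier_vec n \<subseteq> span (set (cols X))"
    using surj X unfolding col_space_def[symmetric] col_space_eq[OF X] by auto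
  then have "span (set (cols X)) = carrier V"
    using span_closed[OF c] by (auto simp: module_vec_simps)
  \<comment> \<open>Restricting the space to its own carrier gives back the same record, so the
    dimension of the column span is that of the whole space.\<close>
  moreover have "vs (carrier V) = V"
    by (rule module.equality) auto
  ultimately have "rank X = n"
    unfolding rank_def by (metis dim_is_n)
  then show ?thesis
    using X by (simp add: full_row_rank_def)
qed

text \<open>Over the complex numbers a monic polynomial is the product of its linear factors, so the
  multiset of roots determines it; the embedding of the reals is injective on coefficients. Through
  this fact the user-chosen error matrix gets the same companion matrix as A - LC.\<close>

lemma char_poly_eqI_eigvals:
  assumes "X \<in> carrier_mat n n" "Y \<in> carrier_mat n n" and e: "eigvals X = eigvals Y"
  shows "char_poly X = char_poly Y"
proof -
  have *: "char_poly (map_mat complex_of_real X) =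
      prod_mset (image_mset (\<lambda>z. [:- z, 1:]) (eigvals X))"
    if "X \<in> carrier_mat n n" for X :: "real mat"
  proof -
    have "lead_coeff (char_poly (map_mat complex_of_real X)) = 1"
      using degree_monic_char_poly[of "map_mat complex_of_real X" n] that by auto
    then show ?thesis
      using complex_poly_decompose_multiset[of "char_poly (map_mat complex_of_real X)"]
      by (simp add: eigvals_def)
  qed
  have "map_poly complex_of_real (char_poly X) = map_poly complex_of_real (char_poly Y)"
    using *[OF assms(1)] *[OF assms(2)]
    unfolding e of_real_hom.char_poly_hom[OF assms(1)] of_real_hom.char_poly_hom[OF assms(2)] by simp
  then show ?thesis
    by (simp add: poly_eq_iff coeff_map_poly)
qed

section \<open>The coefficients D_k of the adjugate of zI - M\<close>

lemma mult_mat_vec_index_sum: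
  assumes "X \<in> carrier_mat n k" "v \<in> carrier_vec k" "i < n"
  shows "(X *\<^sub>v v) $ i = (\<Sum>j<k. X $$ (i, j) * v $ j)"
  using assms by (simp add: scalar_prod_def atLeast0LessThan)

lemma adj_coeff_carrier [simp]: "M \<in> carrier_mat n n \<Longrightarrow> adj_coeff M k \<in> carrier_mat n n"
  using adj_mat(1)[of "char_poly_matrix M" n] by (simp add: adj_coeff_def)

text \<open>The coefficient of z^k in (zI - M) adj(zI - M) = det(zI - M) I, taken entry by entry.
  The case distinction encodes D_{-1} = 0. No bound on k is imposed: indices above n are what later
  shows that the D_k vanish there.\<close>

lemma adj_coeff_recursion:
  assumes M: "M \<in> carrier_mat n n"
  shows "(case k of 0 \<Rightarrow> 0\<^sub>m n n | Suc l \<Rightarrow> adj_coeff M l) =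
    M * adj_coeff M k + coeff (char_poly M) k \<cdot>\<^sub>m 1\<^sub>m n" (is "?l = ?r")
proof (rule eq_matI)
  fix i j assume "i < dim_row ?r" "j < dim_col ?r"
  then have ij: "i < n" "j < n" by auto
  let ?P = "char_poly_matrix M"
  have P: "?P \<in> carrier_mat n n" using M by simp
  have adj: "adj_mat ?P \<in> carrier_mat n n" by (rule adj_mat(1)[OF P])
  \<comment> \<open>Each entry of zI - M is linear in z; its z-part is present only on the diagonal
    and lowers the coefficient index by one, which produces D_{k-1}.\<close>
  have entry: "?P $$ (i, l) = [:- M $$ (i, l), if i = l then 1 else 0:]" if "l < n" for l
    using that ij M by (simp add: char_poly_matrix_def)
  have "coeff ((?P * adj_mat ?P) $$ (i, j)) k = (\<Sum>l<n. coeff (?P $$ (i, l) * adj_mat ?P $$ (l, j)) k)"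
    using ij P adj by (simp add: scalar_prod_def coeff_sum atLeast0LessThan)
  also have "\<dots> = (\<Sum>l<n. - (M $$ (i, l) * coeff (adj_mat ?P $$ (l, j)) k)
      + (if i = l then (case k of 0 \<Rightarrow> 0 | Suc k' \<Rightarrow> coeff (adj_mat ?P $$ (l, j)) k') else 0))"
    by (intro sum.cong) (auto simp: entry coeff_pCons split: nat.splits)
  also have "\<dots> = - (\<Sum>l<n. M $$ (i, l) * coeff (adj_mat ?P $$ (l, j)) k)
      + (case k of 0 \<Rightarrow> 0 | Suc k' \<Rightarrow> coeff (adj_mat ?P $$ (i, j)) k')"
    using ij unfolding sum.distrib by (simp add: sum_negf)
  also have "(\<Sum>l<n. M $$ (i, l) * coeff (adj_mat ?P $$ (l, j)) k) = (M * adj_coeff M k) $$ (i, j)"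
    using ij M adj by (simp add: scalar_prod_def adj_coeff_def atLeast0LessThan)
  also have "(case k of 0 \<Rightarrow> 0 | Suc k' \<Rightarrow> coeff (adj_mat ?P $$ (i, j)) k') = ?l $$ (i, j)"
    using ij adj by (simp add: adj_coeff_def split: nat.splits)
  finally have "?l $$ (i, j) = (M * adj_coeff M k) $$ (i, j) + coeff ((?P * adj_mat ?P) $$ (i, j)) k"
    by simp
  also have "coeff ((?P * adj_mat ?P) $$ (i, j)) k = (coeff (char_poly M) k \<cdot>\<^sub>m 1\<^sub>m n) $$ (i, j)"
    unfolding adj_mat(2)[OF P] using ij by (simp add: char_poly_def)
  finally show "?l $$ (i, j) = ?r $$ (i, j)"
    using ij M by simp
qed (use M in \<open>auto split: nat.splits simp: carrier_matD[OF adj_coeff_carrier[OF M]]\<close>)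

text \<open>The adjugate has finitely many polynomial entries, so some degree bound exists. A crude
  bound suffices, since it only starts the descent to the sharp bound n.\<close>

lemma adj_coeff_eventually_zero:
  assumes M: "M \<in> carrier_mat n n"
  obtains N where "\<And>k. k \<ge> N \<Longrightarrow> adj_coeff M k = 0\<^sub>m n n"
proof
  let ?A = "adj_mat (char_poly_matrix M)"
  let ?N = "Suc (Max ((\<lambda>(i, j). degree (?A $$ (i, j))) ` ({..<n} \<times> {..<n})))"
  have A: "?A \<in> carrier_mat n n"
    by (rule adj_mat(1)) (use M in simp)
  show "adj_coeff M k = 0\<^sub>m n n" if "k \<ge> ?N" for k
  proof (rule eq_matI)
    fix i j assume "i < dim_row (0\<^sub>m n n)" "j < dim_col (0\<^sub>m n n)"
    then have ij: "i < n" "j < n" by auto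
    then have "degree (?A $$ (i, j)) \<in> (\<lambda>(i, j). degree (?A $$ (i, j))) ` ({..<n} \<times> {..<n})"
      by (intro image_eqI[of _ _ "(i, j)"]) auto
    then have "degree (?A $$ (i, j)) < ?N"
      by (simp add: less_Suc_eq_le)
    then show "adj_coeff M k $$ (i, j) = 0\<^sub>m n n $$ (i, j)"
      using ij A that by (simp add: adj_coeff_def coeff_eq_0)
  qed (use A in \<open>auto simp: adj_coeff_def\<close>)
qed

text \<open>The recursion is homogeneous above the degree of the characteristic polynomial, so it
  propagates the vanishing of the high coefficients downwards.\<close>

lemma adj_coeff_eq_zero:
  assumes M: "M \<in> carrier_mat n n" and "k \<ge> n"
  shows "adj_coeff M k = 0\<^sub>m n n"
proof -
  obtain N where N: "\<And>k. k \<ge> N \<Longrightarrow> adj_coeff M k = 0\<^sub>m n n"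
    using adj_coeff_eventually_zero[OF M] by blast
  have "adj_coeff M k = 0\<^sub>m n n" if "k \<le> max N k" "k \<ge> n" for k
    using that
  proof (induction rule: inc_induct)
    case base
    show ?case by (rule N) simp
  next
    case (step l)
    have "coeff (char_poly M) (Suc l) = 0"
      using degree_monic_char_poly[OF M] step by (intro coeff_eq_0) auto
    then show ?case
      using adj_coeff_recursion[OF M, of "Suc l"] step M by auto
  qed
  then show ?thesis using assms by simp
qed

text \<open>The recursion at k = n: there D_n = 0 and the coefficient of z^n is 1.\<close>

lemma adj_coeff_last:
  assumes M: "M \<in> carrier_mat n n" and "n > 0"
  shows "adj_coeff M (n - 1) = 1\<^sub>m n"
  using adj_coeff_recursion[OF M, of n] adj_coeff_eq_zero[OF M, of n] degree_monic_char_poly[OF M]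
    assms by (auto split: nat.splits)

section \<open>The matrices P_v and their intertwining with the companion matrix\<close>

lemma adj_row_carrier:
  assumes M: "M \<in> carrier_mat n n"
  shows "adj_row M \<in> carrier_mat n (n * n)"
proof -
  have "hconcat n (map (adj_coeff M) [0..<n]) \<in> carrier_mat n (length (map (adj_coeff M) [0..<n]) * n)"
    by (rule hconcat_carrier) (use M in auto)
  then show ?thesis using M by (simp add: adj_row_def)
qed

lemma col_mat_carrier [simp]: "v \<in> carrier_vec n \<Longrightarrow> col_mat v \<in> carrier_mat n 1"
  by (auto simp: col_mat_def)

lemma par_vec_carrier [simp]:
  assumes "M \<in> carrier_mat n n" "v \<in> carrier_vec n"
  shows "par_vec M v \<in> carrier_mat n n"
proof -
  have "adj_row M \<in> carrier_mat n (n * n)"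
    using assms by (simp add: adj_row_carrier)
  moreover have "kron (1\<^sub>m n) (col_mat v) \<in> carrier_mat (n * n) (n * 1)"
    using assms by (intro kron_carrier one_carrier_mat col_mat_carrier)
  ultimately show ?thesis
    using assms by (auto simp: par_vec_def)
qed

text \<open>The Kronecker factor spreads w into the blocks w_i v, and the row of the D_i recombines
  them. So the columns of P_v are the vectors D_i v; both identities for P_v below start from this
  form.\<close>

lemma par_vec_mult_index:
  assumes M: "M \<in> carrier_mat n n" and v: "v \<in> carrier_vec n" and w: "w \<in> carrier_vec n" and r: "r < n"
  shows "(par_vec M v *\<^sub>v w) $ r = (\<Sum>i<n. w $ i * (adj_coeff M i *\<^sub>v v) $ r)"
proof -
  have R: "adj_row M \<in> carrier_mat n (n * n)"
    by (rule adj_row_carrier[OF M])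
  have K: "kron (1\<^sub>m n) (col_mat v) \<in> carrier_mat (n * n) n"
    using kron_carrier[OF one_carrier_mat col_mat_carrier[OF v]] by simp
  have "par_vec M v *\<^sub>v w = hconcat n (map (adj_coeff M) [0..<n]) *\<^sub>v
      vconcat (map (\<lambda>i. w $ i \<cdot>\<^sub>v v) [0..<n])"
    using assoc_mult_mat_vec[OF R K w] M kron_one_col_mat_mult[OF w, of v]
    by (simp add: par_vec_def adj_row_def)
  also have "\<dots> $ r = (\<Sum>i\<leftarrow>[0..<n]. (adj_coeff M i *\<^sub>v (w $ i \<cdot>\<^sub>v v)) $ r)"
    by (rule hconcat_mult_vconcat_index[where a = n]) (use M v r in auto)
  also have "\<dots> = (\<Sum>i<n. (adj_coeff M i *\<^sub>v (w $ i \<cdot>\<^sub>v v)) $ r)"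
    by (simp add: sum_list_distinct_conv_sum_set atLeast0LessThan)
  also have "\<dots> = (\<Sum>i<n. w $ i * (adj_coeff M i *\<^sub>v v) $ r)"
    using M v r by (intro sum.cong) (auto simp: mult_mat_vec[OF adj_coeff_carrier[OF M] v]
        carrier_matD[OF adj_coeff_carrier[OF M]])
  finally show ?thesis .
qed

text \<open>The last column of P_v is D_{n-1} v, and D_{n-1} is the identity.\<close>

lemma par_vec_mult_last:
  assumes M: "M \<in> carrier_mat n n" and v: "v \<in> carrier_vec n" and n: "n > 0"
  shows "par_vec M v *\<^sub>v unit_vec n (n - 1) = v"
proof (rule eq_vecI)
  fix r assume "r < dim_vec v"
  then have r: "r < n" using v by simp
  have "(par_vec M v *\<^sub>v unit_vec n (n - 1)) $ r =
      (\<Sum>i<n. unit_vec n (n - 1) $ i * (adj_coeff M i *\<^sub>v v) $ r)"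
    by (rule par_vec_mult_index[OF M v _ r]) simp
  also have "\<dots> = (\<Sum>i<n. if i = n - 1 then (adj_coeff M i *\<^sub>v v) $ r else 0)"
    by (intro sum.cong) auto
  also have "\<dots> = v $ r"
    using n v adj_coeff_last[OF M n] by simp
  finally show "(par_vec M v *\<^sub>v unit_vec n (n - 1)) $ r = v $ r" .
qed (use carrier_matD[OF par_vec_carrier[OF M v]] v in simp)

lemma companion_carrier [simp]:
  "M \<in> carrier_mat n n \<Longrightarrow> companion (char_poly M) \<in> carrier_mat n n"
  using degree_monic_char_poly[of M n] by (auto simp: companion_def)

lemma companion_mult_index:
  assumes w: "w \<in> carrier_vec (degree q)" and i: "i < degree q"
  shows "(companion q *\<^sub>v w) $ i =
    (if Suc i = degree q then - (\<Sum>j<degree q. coeff q j * w $ j) else w $ Suc i)"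
proof -
  have "(companion q *\<^sub>v w) $ i = (\<Sum>j<degree q. companion q $$ (i, j) * w $ j)"
    using w i by (simp add: companion_def scalar_prod_def atLeast0LessThan)
  also have "\<dots> = (\<Sum>j<degree q. if Suc i = degree q then - (coeff q j * w $ j)
      else if j = Suc i then w $ j else 0)"
    using i by (intro sum.cong) (auto simp: companion_def)
  also have "\<dots> = (if Suc i = degree q then - (\<Sum>j<degree q. coeff q j * w $ j) else w $ Suc i)"
    using i by (auto simp: sum_negf)
  finally show ?thesis .
qed

text \<open>On columns, M D_i v = D_{i-1} v - a_i v. The shift from i to i - 1 matches the
  superdiagonal of the companion matrix, and the multiples of v = D_{n-1} v match its last
  row.\<close>

lemma par_vec_companion:
  assumes M: "M \<in> carrier_mat n n" and v: "v \<in> carrier_vec n" and w: "w \<in> carrier_vec n"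
  shows "par_vec M v *\<^sub>v (companion (char_poly M) *\<^sub>v w) = M *\<^sub>v (par_vec M v *\<^sub>v w)"
proof (cases "n = 0")
  case True
  then show ?thesis using assms carrier_matD[OF par_vec_carrier[OF M v]] by (intro eq_vecI) auto
next
  case False
  then obtain k where n: "n = Suc k" by (cases n) auto
  let ?q = "char_poly M" and ?D = "\<lambda>i. adj_coeff M i *\<^sub>v v"
  have deg: "degree ?q = n" using degree_monic_char_poly[OF M] by simp
  have P: "par_vec M v \<in> carrier_mat n n" using M v by simp
  have D: "?D i \<in> carrier_vec n" for i
    by (rule mult_mat_vec_carrier[OF adj_coeff_carrier[OF M] v])
  \<comment> \<open>The adjugate recursion applied to v and solved for the term with M.\<close>
  have rec: "M *\<^sub>v ?D i = (case i of 0 \<Rightarrow> 0\<^sub>v n | Suc l \<Rightarrow> ?D l) - coeff ?q i \<cdot>\<^sub>v v" for i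
  proof -
    have "(case i of 0 \<Rightarrow> 0\<^sub>v n | Suc l \<Rightarrow> ?D l) = (case i of 0 \<Rightarrow> 0\<^sub>m n n | Suc l \<Rightarrow> adj_coeff M l) *\<^sub>v v"
      using v by (auto split: nat.splits)
    also have "\<dots> = M *\<^sub>v ?D i + (coeff ?q i \<cdot>\<^sub>m 1\<^sub>m n) *\<^sub>v v"
      unfolding adj_coeff_recursion[OF M]
      using M v assoc_mult_mat_vec[OF M adj_coeff_carrier[OF M] v]
      by (subst add_mult_distrib_mat_vec[where nr = n and nc = n]) auto
    also have "(coeff ?q i \<cdot>\<^sub>m 1\<^sub>m n) *\<^sub>v v = coeff ?q i \<cdot>\<^sub>v v"
      using v by (intro eq_vecI) (auto simp: scalar_prod_def mult.assoc
          sum_distrib_left[symmetric] if_distrib[of "\<lambda>a. a * _"] cong: if_cong)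
    finally show ?thesis
      using M v D by auto
  qed
  show ?thesis
  proof (rule eq_vecI)
    fix r assume "r < dim_vec (M *\<^sub>v (par_vec M v *\<^sub>v w))"
    then have r: "r < n" using M by simp
    have last: "?D k = v" using adj_coeff_last[OF M] n v by simp
    have "(M *\<^sub>v (par_vec M v *\<^sub>v w)) $ r = (\<Sum>l<n. M $$ (r, l) * (\<Sum>i<n. w $ i * ?D i $ l))"
      unfolding mult_mat_vec_index_sum[OF M mult_mat_vec_carrier[OF P w] r]
      by (intro sum.cong) (auto simp: par_vec_mult_index[OF M v w] simp del: index_mult_mat_vec)
    also have "\<dots> = (\<Sum>i<n. w $ i * (\<Sum>l<n. M $$ (r, l) * ?D i $ l))"
      unfolding sum_distrib_left by (subst sum.swap) (simp add: mult_ac)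
    also have "\<dots> = (\<Sum>i<n. w $ i * (M *\<^sub>v ?D i) $ r)"
      unfolding mult_mat_vec_index_sum[OF M D r] ..
    also have "\<dots> = (\<Sum>i<n. w $ i * (case i of 0 \<Rightarrow> 0 | Suc l \<Rightarrow> ?D l $ r)) -
        (\<Sum>i<n. coeff ?q i * w $ i) * v $ r"
      unfolding rec sum_distrib_right sum_subtractf[symmetric] using r v carrier_vecD[OF D]
      by (intro sum.cong) (auto split: nat.splits simp: algebra_simps)
    \<comment> \<open>The term i = 0 drops out because D_{-1} = 0, and v is rewritten as the last
      column \<open>?D k\<close>; what remains is the product with the shifted vector.\<close>
    also have "\<dots> = (\<Sum>i<k. w $ Suc i * ?D i $ r) - (\<Sum>i<n. coeff ?q i * w $ i) * ?D k $ r"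
      unfolding last n sum.lessThan_Suc_shift by simp
    also have "\<dots> = (\<Sum>i<n. (companion ?q *\<^sub>v w) $ i * ?D i $ r)"
      unfolding n sum.lessThan_Suc using w deg n
      by (simp add: companion_mult_index algebra_simps)
    also have "\<dots> = (par_vec M v *\<^sub>v (companion ?q *\<^sub>v w)) $ r"
      by (rule par_vec_mult_index[OF M v mult_mat_vec_carrier[OF companion_carrier[OF M] w] r, symmetric])
    finally show "(par_vec M v *\<^sub>v (companion ?q *\<^sub>v w)) $ r = (M *\<^sub>v (par_vec M v *\<^sub>v w)) $ r" ..
  qed (use M carrier_matD[OF P] in simp)
qed

section \<open>Filters defined by z-transforms, and their recursion\<close>

text \<open>The series variable is the inverse of z, so multiplying by z^i advances the sequence by
  i steps.\<close>

lemma fls_nth_zpoly_mult: "fls_nth (zpoly q * G) s = (\<Sum>i\<le>degree q. coeff q i * fls_nth G (s + int i))"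
proof -
  have "zpoly q = (\<Sum>i\<le>degree q. fls_const (coeff q i) * fls_X_inv ^ i)"
    by (simp add: zpoly_def poly_altdef coeff_map_poly degree_map_poly)
  then have "zpoly q * G = (\<Sum>i\<le>degree q. fls_const (coeff q i) * (fls_X_inv ^ i * G))"
    by (simp only: sum_distrib_right mult.assoc)
  then show ?thesis
    unfolding fls_X_inv_power_times_conv_shift by (simp add: fls_nth_sum)
qed

lemma zpoly_nonzero: "q \<noteq> 0 \<Longrightarrow> zpoly q \<noteq> 0"
proof
  assume q: "q \<noteq> 0" and "zpoly q = 0"
  \<comment> \<open>The index is that of z^(degree q), where the leading coefficient of q
    stands.\<close>
  then have "0 = fls_nth (zpoly q * 1) (- int (degree q))" by simp
  also have "\<dots> = (\<Sum>i\<le>degree q. if i = degree q then coeff q i else 0)"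
    unfolding fls_nth_zpoly_mult by (intro sum.cong) auto
  finally show False using q by simp
qed

text \<open>Dividing by a polynomial of degree n delays a causal signal by n steps: otherwise the
  lowest term of the quotient times the leading term of q would give the input a nonzero sample at
  negative time. The zero initial state of the filters follows.\<close>

lemma fls_nth_div_zpoly_eq_zero:
  assumes q: "q \<noteq> 0" and s: "s < int (degree q)"
  shows "fls_nth (ztrans f / zpoly q) s = 0"
proof (rule ccontr)
  let ?G = "ztrans f / zpoly q"
  assume nz: "fls_nth ?G s \<noteq> 0"
  let ?s = "fls_subdegree ?G"
  have G: "?G \<noteq> 0" and le: "?s \<le> s"
    using nz by (auto intro: fls_subdegree_leI)
  \<comment> \<open>At this index every term with i < degree q reads \<open>?G\<close> below its
    subdegree, so only the leading term survives.\<close>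
  have "fls_nth (zpoly q * ?G) (?s - int (degree q)) =
      (\<Sum>i\<le>degree q. if i = degree q then coeff q i * fls_nth ?G ?s else 0)"
    unfolding fls_nth_zpoly_mult by (intro sum.cong) auto
  moreover have "zpoly q * ?G = ztrans f" using zpoly_nonzero[OF q] by simp
  moreover have "fls_nth (ztrans f) (?s - int (degree q)) = 0"
    using le s by (simp add: ztrans_def)
  ultimately have "lead_coeff q * fls_nth ?G ?s = 0" by simp
  then show False using q G by simp
qed

text \<open>The factor z^k is an advance by k, so the components of the filter state are consecutive
  samples of the single sequence with transform F(z)/q(z).\<close>

lemma io_filter_index:
  assumes "k < degree q"
  shows "io_filter q f t $ k = fls_nth (ztrans f / zpoly q) (int t + int k)"
proof -
  have "fls_X_inv ^ k * ztrans f / zpoly q = fls_shift (int k) (ztrans f / zpoly q)"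
    by (metis times_divide_eq_right fls_X_inv_power_times_conv_shift(1))
  then show ?thesis
    using assms by (simp add: io_filter_def inv_ztrans_def)
qed

lemma io_filter_carrier [simp]: "io_filter q f t \<in> carrier_vec (degree q)"
  by (simp add: io_filter_def)

lemma io_filter_0: "q \<noteq> 0 \<Longrightarrow> io_filter q f 0 = 0\<^sub>v (degree q)"
  by (intro eq_vecI) (auto simp: io_filter_index fls_nth_div_zpoly_eq_zero carrier_vecD[OF io_filter_carrier])

text \<open>Advancing time slides the window of samples by one. The sample that enters is found by
  reading q G = F at time t and solving for the leading term, which has coefficient 1.\<close>

lemma io_filter_Suc:
  assumes q: "lead_coeff q = 1"
  shows "io_filter q f (Suc t) =
    companion q *\<^sub>v io_filter q f t + f t \<cdot>\<^sub>v unit_vec (degree q) (degree q - 1)" (is "?l = ?r")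
proof (rule eq_vecI)
  let ?G = "ztrans f / zpoly q"
  fix k assume "k < dim_vec ?r"
  then have k: "k < degree q" by simp
  have q0: "q \<noteq> 0" using q by auto
  have "f t = fls_nth (zpoly q * ?G) (int t)"
    using zpoly_nonzero[OF q0] by (simp add: ztrans_def)
  also have "\<dots> = (\<Sum>i<degree q. coeff q i * fls_nth ?G (int t + int i)) +
      fls_nth ?G (int t + int (degree q))"
    unfolding fls_nth_zpoly_mult lessThan_Suc_atMost[symmetric] using q by simp
  also have "(\<Sum>i<degree q. coeff q i * fls_nth ?G (int t + int i)) =
      (\<Sum>i<degree q. coeff q i * io_filter q f t $ i)"
    by (intro sum.cong) (auto simp: io_filter_index)
  finally have "fls_nth ?G (int t + int (degree q)) = f t - (\<Sum>i<degree q. coeff q i * io_filter q f t $ i)"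
    by simp
  moreover have "?l $ k = fls_nth ?G (int t + int (Suc k))"
    using k by (simp add: io_filter_index add_ac)
  moreover have "?r $ k = (companion q *\<^sub>v io_filter q f t) $ k + (if Suc k = degree q then f t else 0)"
    using k by (auto simp: companion_def)
  ultimately show "?l $ k = ?r $ k"
    using k by (auto simp: companion_mult_index io_filter_index simp del: of_nat_Suc index_mult_mat_vec)
qed (simp add: io_filter_def companion_def)

lemma io_filters_carrier [simp]: "io_filters q k w t \<in> carrier_vec (k * degree q)"
proof -
  let ?vs = "map (\<lambda>i. io_filter q (\<lambda>s. w s $ i) t) [0..<k]"
  have "vconcat ?vs \<in> carrier_vec (length ?vs * degree q)"
    by (rule vconcat_carrier) auto
  then show ?thesis by (simp add: io_filters_def)
qed

lemma io_filters_0: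
  assumes "q \<noteq> 0"
  shows "io_filters q k w 0 = 0\<^sub>v (k * degree q)"
  using vconcat_zero[of "degree q" "[0..<k]"] by (simp add: io_filters_def io_filter_0[OF assms])

lemma io_filters_Suc:
  assumes q: "lead_coeff q = 1" and w: "w t \<in> carrier_vec k"
  shows "io_filters q k w (Suc t) = kron (1\<^sub>m k) (companion q) *\<^sub>v io_filters q k w t +
    kron (1\<^sub>m k) (col_mat (unit_vec (degree q) (degree q - 1))) *\<^sub>v w t"
proof -
  let ?f = "\<lambda>i. io_filter q (\<lambda>s. w s $ i)" and ?b = "unit_vec (degree q) (degree q - 1)"
  have C: "companion q \<in> carrier_mat (degree q) (degree q)"
    by (simp add: companion_def)
  have "io_filters q k w (Suc t) =
      vconcat (map (\<lambda>i. companion q *\<^sub>v ?f i t) [0..<k]) + vconcat (map (\<lambda>i. w t $ i \<cdot>\<^sub>v ?b) [0..<k])"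
    unfolding io_filters_def io_filter_Suc[OF q]
    by (rule vconcat_add[where a = "degree q"]) (use C in \<open>auto intro: mult_mat_vec_carrier\<close>)
  also have "vconcat (map (\<lambda>i. w t $ i \<cdot>\<^sub>v ?b) [0..<k]) = kron (1\<^sub>m k) (col_mat ?b) *\<^sub>v w t"
    by (rule kron_one_col_mat_mult[OF w, symmetric])
  also have "vconcat (map (\<lambda>i. companion q *\<^sub>v ?f i t) [0..<k]) =
      kron (1\<^sub>m k) (companion q) *\<^sub>v io_filters q k w t"
  proof -
    have "kron (1\<^sub>m (length (map (\<lambda>i. ?f i t) [0..<k]))) (companion q) *\<^sub>v
        vconcat (map (\<lambda>i. ?f i t) [0..<k]) = vconcat (map ((*\<^sub>v) (companion q)) (map (\<lambda>i. ?f i t) [0..<k]))"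
      by (rule kron_one_mult_vconcat[OF C]) auto
    then show ?thesis by (simp add: io_filters_def comp_def)
  qed
  finally show ?thesis .
qed

text \<open>Lets inputs and outputs be handled as one signal with m + p channels, matching the
  factor I_{m+p} in the substitute system.\<close>

lemma io_filters_append_vec:
  assumes u: "\<And>s. u s \<in> carrier_vec m" and y: "\<And>s. y s \<in> carrier_vec p"
  shows "io_filters q (m + p) (\<lambda>s. u s @\<^sub>v y s) t = io_filters q m u t @\<^sub>v io_filters q p y t"
proof -
  have uy: "dim_vec (u s) = m" "dim_vec (y s) = p" for s
    using u[of s] y[of s] by auto
  have "[0..<m + p] = [0..<m] @ map (\<lambda>i. i + m) [0..<p]"
    by (metis map_add_upt upt_add_eq_append add.commute le0)
  moreover have "map (\<lambda>i. io_filter q (\<lambda>s. (u s @\<^sub>v y s) $ i) t) [0..<m] =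
      map (\<lambda>i. io_filter q (\<lambda>s. u s $ i) t) [0..<m]"
    by (rule map_cong) (auto simp: uy)
  moreover have "map (\<lambda>i. io_filter q (\<lambda>s. (u s @\<^sub>v y s) $ (i + m)) t) [0..<p] =
      map (\<lambda>i. io_filter q (\<lambda>s. y s $ i) t) [0..<p]"
    by (rule map_cong) (auto simp: uy)
  ultimately show ?thesis
    by (simp only: io_filters_def map_append map_map comp_def vconcat_append)
qed

section \<open>Observer and error trajectories expressed through filter states\<close>

lemma par_mat_carrier [simp]:
  assumes M: "M \<in> carrier_mat n n" and X: "X \<in> carrier_mat n k"
  shows "par_mat M X \<in> carrier_mat n (k * n)"
proof -
  let ?Xs = "map (\<lambda>j. par_vec M (col X j)) [0..<k]"
  have "hconcat n ?Xs \<in> carrier_mat n (length ?Xs * n)"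
    by (rule hconcat_carrier) (use M X in auto)
  then show ?thesis using M X by (simp add: par_mat_def)
qed

text \<open>In channel i the matrix P of the i-th column of X carries the companion dynamics to M
  and the input vector to that column. Summing the channels, the weighted columns add up to X
  w.\<close>

lemma par_mat_io_filters_Suc:
  assumes M: "M \<in> carrier_mat n n" and X: "X \<in> carrier_mat n k" and w: "w t \<in> carrier_vec k"
    and n: "n > 0"
  shows "par_mat M X *\<^sub>v io_filters (char_poly M) k w (Suc t) =
    M *\<^sub>v (par_mat M X *\<^sub>v io_filters (char_poly M) k w t) + X *\<^sub>v w t"
proof -
  let ?q = "char_poly M"
  let ?f = "\<lambda>i. io_filter ?q (\<lambda>s. w s $ i)" and ?P = "\<lambda>i. par_vec M (col X i)"
  let ?b = "unit_vec n (n - 1) :: real vec"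
  have deg: "degree ?q = n" and monic: "lead_coeff ?q = 1"
    using degree_monic_char_poly[OF M] by auto
  have c: "col X i \<in> carrier_vec n" for i using X by auto
  have f: "?f i s \<in> carrier_vec n" for i s
    using io_filter_carrier[of ?q] by (simp add: deg)
  have P: "?P i \<in> carrier_mat n n" for i using M c by simp
  have S: "par_mat M X \<in> carrier_mat n (k * n)" using M X by simp
  have F: "io_filters ?q k w t \<in> carrier_vec (k * n)"
    using io_filters_carrier[of ?q k] by (simp add: deg)
  have sum: "(par_mat M X *\<^sub>v io_filters ?q k w s) $ r = (\<Sum>i<k. (?P i *\<^sub>v ?f i s) $ r)"
    if "r < n" for r s
  proof -
    have "(hconcat n (map ?P [0..<k]) *\<^sub>v vconcat (map (\<lambda>i. ?f i s) [0..<k])) $ r =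
        (\<Sum>i\<leftarrow>[0..<k]. (?P i *\<^sub>v ?f i s) $ r)"
      by (rule hconcat_mult_vconcat_index[where a = n]) (use P f that in auto)
    then show ?thesis
      using M X by (simp add: par_mat_def io_filters_def sum_list_distinct_conv_sum_set atLeast0LessThan)
  qed
  have step: "?P i *\<^sub>v ?f i (Suc t) = M *\<^sub>v (?P i *\<^sub>v ?f i t) + w t $ i \<cdot>\<^sub>v col X i" for i
  proof -
    have C: "companion ?q *\<^sub>v ?f i t \<in> carrier_vec n"
      by (rule mult_mat_vec_carrier[OF companion_carrier[OF M] f])
    have "?P i *\<^sub>v ?f i (Suc t) = ?P i *\<^sub>v (companion ?q *\<^sub>v ?f i t) + ?P i *\<^sub>v (w t $ i \<cdot>\<^sub>v ?b)"
      unfolding io_filter_Suc[OF monic] deg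
      by (rule mult_add_distrib_mat_vec[OF P C]) simp
    also have "?P i *\<^sub>v (w t $ i \<cdot>\<^sub>v ?b) = w t $ i \<cdot>\<^sub>v col X i"
      using mult_mat_vec[OF P] par_vec_mult_last[OF M c n] by simp
    finally show ?thesis by (simp add: par_vec_companion[OF M c f])
  qed
  show ?thesis
  proof (rule eq_vecI)
    fix r assume "r < dim_vec (M *\<^sub>v (par_mat M X *\<^sub>v io_filters ?q k w t) + X *\<^sub>v w t)"
    then have r: "r < n" using X by simp
    have "(M *\<^sub>v (par_mat M X *\<^sub>v io_filters ?q k w t)) $ r =
        (\<Sum>l<n. M $$ (r, l) * (\<Sum>i<k. (?P i *\<^sub>v ?f i t) $ l))"
      unfolding mult_mat_vec_index_sum[OF M mult_mat_vec_carrier[OF S F] r]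
      by (intro sum.cong) (auto simp: sum simp del: index_mult_mat_vec)
    also have "\<dots> = (\<Sum>i<k. \<Sum>l<n. M $$ (r, l) * (?P i *\<^sub>v ?f i t) $ l)"
      unfolding sum_distrib_left by (rule sum.swap)
    also have "\<dots> = (\<Sum>i<k. (M *\<^sub>v (?P i *\<^sub>v ?f i t)) $ r)"
      unfolding mult_mat_vec_index_sum[OF M mult_mat_vec_carrier[OF P f] r] ..
    finally have 1: "(M *\<^sub>v (par_mat M X *\<^sub>v io_filters ?q k w t)) $ r = \<dots>" .
    have 2: "(X *\<^sub>v w t) $ r = (\<Sum>i<k. (w t $ i \<cdot>\<^sub>v col X i) $ r)"
      using X w r by (simp add: scalar_prod_def atLeast0LessThan mult.commute)
    show "(par_mat M X *\<^sub>v io_filters ?q k w (Suc t)) $ r =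
        (M *\<^sub>v (par_mat M X *\<^sub>v io_filters ?q k w t) + X *\<^sub>v w t) $ r"
      unfolding sum[OF r] step using r M X P
      by (simp add: 1 2 sum.distrib del: index_mult_mat_vec(1) index_smult_vec(1))
  qed (use M X carrier_matD[OF S] in simp)
qed

text \<open>Both sides start at zero and obey the same recursion. The signals u and y are arbitrary,
  so this applies to the observer itself and also to the zero-start trajectories of the rank
  argument.\<close>

lemma observer_state_eq:
  assumes M: "M \<in> carrier_mat n n" and B: "B \<in> carrier_mat n m" and L: "L \<in> carrier_mat n p"
    and n: "n > 0"
    and u: "\<And>t. u t \<in> carrier_vec m" and y: "\<And>t. y t \<in> carrier_vec p"
    and z0: "z 0 = 0\<^sub>v n" and z: "\<And>t. z (Suc t) = M *\<^sub>v z t + B *\<^sub>v u t + L *\<^sub>v y t"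
  shows "z t = par_mat M B *\<^sub>v io_filters (char_poly M) m u t +
    par_mat M L *\<^sub>v io_filters (char_poly M) p y t"
proof (induction t)
  case 0
  have q: "degree (char_poly M) = n" "char_poly M \<noteq> 0"
    using degree_monic_char_poly[OF M] by auto
  have zero: "X *\<^sub>v 0\<^sub>v k = 0\<^sub>v n" if "X \<in> carrier_mat n k" for X :: "real mat" and k
    using that by (intro eq_vecI) auto
  show ?case
    using M B L by (simp add: z0 io_filters_0 q zero[OF par_mat_carrier])
next
  case (Suc t)
  let ?f = "par_mat M B *\<^sub>v io_filters (char_poly M) m u t"
    and ?g = "par_mat M L *\<^sub>v io_filters (char_poly M) p y t"
  have q: "degree (char_poly M) = n" using degree_monic_char_poly[OF M] by auto
  have fg: "?f \<in> carrier_vec n" "?g \<in> carrier_vec n"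
    by (rule mult_mat_vec_carrier[OF par_mat_carrier[OF M B]] mult_mat_vec_carrier[OF par_mat_carrier[OF M L]];
        use io_filters_carrier[of "char_poly M"] in \<open>simp add: q\<close>)+
  have "z (Suc t) = (M *\<^sub>v ?f + M *\<^sub>v ?g) + B *\<^sub>v u t + L *\<^sub>v y t"
    unfolding z Suc by (simp add: mult_add_distrib_mat_vec[OF M fg])
  also have "\<dots> = (M *\<^sub>v ?f + B *\<^sub>v u t) + (M *\<^sub>v ?g + L *\<^sub>v y t)"
    by (rule eq_vecI) (use M B L in auto)
  finally show ?case
    by (simp add: par_mat_io_filters_Suc[OF M B u n] par_mat_io_filters_Suc[OF M L y n])
qed

text \<open>Each factor M is moved through P as a factor A_s, starting from P b_s = e(0). The vector
  A_s^t b_s depends on M only through its characteristic polynomial, so it is shared by both error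
  systems.\<close>

lemma autonomous_state_eq:
  assumes M: "M \<in> carrier_mat n n" and n: "n > 0"
    and e0: "e 0 \<in> carrier_vec n" and e: "\<And>t. e (Suc t) = M *\<^sub>v e t"
  shows "e t = par_vec M (e 0) *\<^sub>v (((*\<^sub>v) (companion (char_poly M)) ^^ t) (unit_vec n (n - 1)))"
proof (induction t)
  case 0
  show ?case using par_vec_mult_last[OF M e0 n] by simp
next
  case (Suc t)
  have "((*\<^sub>v) (companion (char_poly M)) ^^ t) (unit_vec n (n - 1)) \<in> carrier_vec n"
    by (induction t) (auto intro: mult_mat_vec_carrier companion_carrier[OF M])
  then show ?case
    using par_vec_companion[OF M e0] Suc by (simp add: e)
qed

section \<open>Block products and the inverse used in the final assembly\<close>

lemma diag_block_mat_pair_mult: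
  fixes X Y :: "'a :: comm_ring_1 mat"
  assumes X: "X \<in> carrier_mat a b" and Y: "Y \<in> carrier_mat c d"
    and v: "v \<in> carrier_vec b" and w: "w \<in> carrier_vec d"
  shows "diag_block_mat [X, Y] *\<^sub>v (v @\<^sub>v w) = X *\<^sub>v v @\<^sub>v Y *\<^sub>v w"
proof -
  have "diag_block_mat [Y] = Y"
    by (intro eq_matI) auto
  then have "diag_block_mat [X, Y] = four_block_mat X (0\<^sub>m a d) (0\<^sub>m c b) Y"
    using X Y by simp
  then have "diag_block_mat [X, Y] *\<^sub>v (v @\<^sub>v w) =
      (X *\<^sub>v v + 0\<^sub>m a d *\<^sub>v w) @\<^sub>v (0\<^sub>m c b *\<^sub>v v + Y *\<^sub>v w)"
    using four_block_mat_mult_vec[OF X _ _ Y v w] by simp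
  also have "\<dots> = X *\<^sub>v v @\<^sub>v Y *\<^sub>v w"
    using X Y v w by auto
  finally show ?thesis .
qed

lemma hconcat_triple_mult:
  fixes X Y Z :: "'a :: comm_ring_1 mat"
  assumes "X \<in> carrier_mat n a" "Y \<in> carrier_mat n b" "Z \<in> carrier_mat n c"
    and "u \<in> carrier_vec a" "v \<in> carrier_vec b" "w \<in> carrier_vec c"
  shows "hconcat n [X, Y, Z] *\<^sub>v vconcat [u, v, w] = X *\<^sub>v u + (Y *\<^sub>v v + Z *\<^sub>v w)"
proof -
  have Z: "append_cols Z (0\<^sub>m n 0) \<in> carrier_mat n (c + 0)"
    by (rule append_cols_carrier) (use assms in auto)
  have Zw: "append_cols Z (0\<^sub>m n 0) *\<^sub>v (w @\<^sub>v 0\<^sub>v 0) = Z *\<^sub>v w"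
    unfolding append_cols_mult_append_vec[OF assms(3) zero_carrier_mat assms(6) zero_carrier_vec]
    using assms(3) by (intro eq_vecI) auto
  have YZ: "append_cols Y (append_cols Z (0\<^sub>m n 0)) \<in> carrier_mat n (b + (c + 0))"
    by (rule append_cols_carrier[OF assms(2) Z])
  have "w @\<^sub>v 0\<^sub>v 0 \<in> carrier_vec (c + 0)" "v @\<^sub>v w @\<^sub>v 0\<^sub>v 0 \<in> carrier_vec (b + (c + 0))"
    by (intro append_carrier_vec assms zero_carrier_vec)+
  then show ?thesis
    unfolding hconcat_Cons hconcat_Nil vconcat_Cons vconcat_Nil
    using append_cols_mult_append_vec[OF assms(1) YZ assms(4)]
      append_cols_mult_append_vec[OF assms(2) Z assms(5)] Zw by simp
qed

lemma hconcat_triple_carrier: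
  assumes "X \<in> carrier_mat n a" "Y \<in> carrier_mat n b" "Z \<in> carrier_mat n c"
  shows "hconcat n [X, Y, Z] \<in> carrier_mat n (a + b + c)"
proof -
  have "hconcat n [X, Y, Z] \<in> carrier_mat n (a + (b + (c + 0)))"
    unfolding hconcat_Cons hconcat_Nil by (intro append_cols_carrier assms zero_carrier_mat)
  then show ?thesis by (simp add: add.assoc)
qed

text \<open>\<open>mat_inverse\<close> returns an option; invertibility places X among the units of
  the matrix ring, which excludes \<open>None\<close>.\<close>

lemma invertible_mat_the_mat_inverse:
  fixes X :: "'a :: field mat"
  assumes X: "X \<in> carrier_mat n n" and inv: "invertible_mat X"
  shows "the (mat_inverse X) \<in> carrier_mat n n" "the (mat_inverse X) * X = 1\<^sub>m n"
proof -
  obtain Y where Y: "X * Y = 1\<^sub>m n" "Y * X = 1\<^sub>m (dim_row Y)"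
    using inv X by (auto simp: invertible_mat_def inverts_mat_def)
  \<comment> \<open>\<open>inverts_mat\<close> fixes no size for Y; comparing column counts in the
    two products gives n columns and n rows.\<close>
  then have "Y \<in> carrier_mat n n"
    using X by (metis carrier_matD carrier_mat_triv index_mult_mat(3) index_one_mat(3))
  then have "X \<in> Units (ring_mat TYPE('a) n ())"
    using X Y by (auto simp: Units_def ring_mat_def)
  then obtain Z where "mat_inverse X = Some Z"
    using mat_inverse(1)[OF X, where ?b = "()"] by (cases "mat_inverse X") auto
  then show "the (mat_inverse X) \<in> carrier_mat n n" "the (mat_inverse X) * X = 1\<^sub>m n"
    using mat_inverse(2)[OF X] by auto
qed

section \<open>State representation, filter dynamics and the rank argument combined\<close>

theorem theorem3p5:
  fixes n m p :: nat
    and A B C Q Qx Qx_half L A\<^sub>\<epsilon> :: "real mat"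
    and x x\<^sub>c u y \<eta>\<^sub>\<epsilon> :: "nat \<Rightarrow> real vec"
    and \<Lambda> :: "real poly"
    and \<epsilon> \<eta> :: "nat \<Rightarrow> real vec"
    and b\<^sub>s :: "real vec"
    and A\<^sub>s \<A>\<^sub>s \<B>\<^sub>s S\<^sub>u S\<^sub>y S\<^sub>\<epsilon>\<^sub>x S\<^sub>\<epsilon>\<^sub>\<eta> S\<^sub>\<epsilon> S :: "real mat"
  assumes A: "A \<in> carrier_mat n n"
    and B: "B \<in> carrier_mat n m"
    and C: "C \<in> carrier_mat p n"
    and L: "L \<in> carrier_mat n p"
    and Q: "Q \<in> carrier_mat p p" "sym_psd Q"
    and p_le_n: "p \<le> n"
    and C_rank: "full_row_rank C"
    and AB: "controllable A B"
    and AC: "observable A C"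
    and Qx: "Qx = transpose_mat C * Q * C"
    and Qx_half: "psd_sqrt_of Qx_half Qx"
    and AQ: "observable A Qx_half"
    \<comment> \<open>the system\<close>
    and x_0: "x 0 \<in> carrier_vec n"
    and u: "\<And>t. u t \<in> carrier_vec m"
    and x_Suc: "\<And>t. x (Suc t) = A *\<^sub>v x t + B *\<^sub>v u t"
    and y: "\<And>t. y t = C *\<^sub>v x t"
    \<comment> \<open>the observer\<close>
    and xc_0: "x\<^sub>c 0 = 0\<^sub>v n"
    and xc_Suc: "\<And>t. x\<^sub>c (Suc t) = (A - L * C) *\<^sub>v x\<^sub>c t + B *\<^sub>v u t + L *\<^sub>v y t"
    and err: "\<And>t. \<epsilon> t = x t - x\<^sub>c t"
    \<comment> \<open>the user-chosen error system\<close>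
    and A\<epsilon>: "A\<^sub>\<epsilon> \<in> carrier_mat n n" "eigvals A\<^sub>\<epsilon> = eigvals (A - L * C)"
    and \<eta>\<epsilon>_0: "\<eta>\<^sub>\<epsilon> 0 \<in> carrier_vec n" "\<eta>\<^sub>\<epsilon> 0 \<noteq> 0\<^sub>v n"
    and \<eta>\<epsilon>_Suc: "\<And>t. \<eta>\<^sub>\<epsilon> (Suc t) = A\<^sub>\<epsilon> *\<^sub>v \<eta>\<^sub>\<epsilon> t"
    and S\<epsilon>\<eta>: "S\<^sub>\<epsilon>\<^sub>\<eta> = par_vec A\<^sub>\<epsilon> (\<eta>\<^sub>\<epsilon> 0)" "invertible_mat S\<^sub>\<epsilon>\<^sub>\<eta>"
    \<comment> \<open>the derived objects\<close>
    and \<Lambda>: "\<Lambda> = char_poly (A - L * C)"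
    and As: "A\<^sub>s = companion \<Lambda>"
    and bs: "b\<^sub>s = unit_vec n (n - 1)"
    and AAs: "\<A>\<^sub>s = diag_block_mat [kron (1\<^sub>m (m + p)) A\<^sub>s, A\<^sub>\<epsilon>]"
    and BBs: "\<B>\<^sub>s = diag_block_mat [kron (1\<^sub>m (m + p)) (col_mat b\<^sub>s), 0\<^sub>m n 1]"
    and Su: "S\<^sub>u = par_mat (A - L * C) B"
    and Sy: "S\<^sub>y = par_mat (A - L * C) L"
    and S\<epsilon>x: "S\<^sub>\<epsilon>\<^sub>x = par_vec (A - L * C) (\<epsilon> 0)"
    and S\<epsilon>: "S\<^sub>\<epsilon> = S\<^sub>\<epsilon>\<^sub>x * the (mat_inverse S\<^sub>\<epsilon>\<^sub>\<eta>)"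
    and S: "S = hconcat n [S\<^sub>u, S\<^sub>y, S\<^sub>\<epsilon>]"
    and \<eta>: "\<And>t. \<eta> t = vconcat [io_filters \<Lambda> m u t, io_filters \<Lambda> p y t, \<eta>\<^sub>\<epsilon> t]"
  shows "(\<forall>t. \<eta> t \<in> carrier_vec ((m + p + 1) * n) \<and> x t = S *\<^sub>v \<eta> t)
       \<and> (\<forall>t. \<eta> (Suc t) = \<A>\<^sub>s *\<^sub>v \<eta> t + \<B>\<^sub>s *\<^sub>v vconcat [u t, y t, 0\<^sub>v 1])
       \<and> \<eta> 0 = vconcat [0\<^sub>v ((m + p) * n), \<eta>\<^sub>\<epsilon> 0]
       \<and> \<eta> 0 \<noteq> 0\<^sub>v ((m + p + 1) * n)
       \<and> S \<in> carrier_mat n ((m + p + 1) * n)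
       \<and> full_row_rank S"
proof -
  let ?M = "A - L * C"
  have M: "?M \<in> carrier_mat n n" by (intro minus_carrier_mat mult_carrier_mat[OF L C])
  \<comment> \<open>A nonzero initial vector cannot live in dimension zero, so the last unit vector
    b_s makes sense.\<close>
  have n: "n > 0"
    using \<eta>\<epsilon>_0 by (cases n) auto
  have deg: "degree \<Lambda> = n" and monic: "lead_coeff \<Lambda> = 1" and \<Lambda>0: "\<Lambda> \<noteq> 0"
    using degree_monic_char_poly[OF M] by (auto simp: \<Lambda>)
  have char_poly_A\<epsilon>: "char_poly A\<^sub>\<epsilon> = \<Lambda>"
    unfolding \<Lambda> by (rule char_poly_eqI_eigvals[OF A\<epsilon>(1) M A\<epsilon>(2)])
  have x: "x t \<in> carrier_vec n" for t
    by (induction t) (auto simp: x_0 x_Suc u intro!: add_carrier_vec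
        mult_mat_vec_carrier[OF A] mult_mat_vec_carrier[OF B])
  have yc: "y t \<in> carrier_vec p" for t unfolding y by (rule mult_mat_vec_carrier[OF C x])
  have xc: "x\<^sub>c t \<in> carrier_vec n" for t
    by (induction t) (auto simp: xc_0 xc_Suc intro!: add_carrier_vec mult_mat_vec_carrier[OF M]
        mult_mat_vec_carrier[OF B] mult_mat_vec_carrier[OF L] u yc)
  have \<eta>\<epsilon>: "\<eta>\<^sub>\<epsilon> t \<in> carrier_vec n" for t
    by (induction t) (auto simp: \<eta>\<epsilon>_0 \<eta>\<epsilon>_Suc intro!: mult_mat_vec_carrier[OF A\<epsilon>(1)])
  have \<epsilon>c: "\<epsilon> t \<in> carrier_vec n" for t
    unfolding err by (rule minus_carrier_vec[OF x xc])
  have fu: "io_filters \<Lambda> m u' t \<in> carrier_vec (m * n)" for u' t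
    using io_filters_carrier[of \<Lambda> m] by (simp add: deg)
  have fy: "io_filters \<Lambda> p y' t \<in> carrier_vec (p * n)" for y' t
    using io_filters_carrier[of \<Lambda> p] by (simp add: deg)
  have M_mult: "?M *\<^sub>v z = A *\<^sub>v z - L *\<^sub>v (C *\<^sub>v z)" if "z \<in> carrier_vec n" for z
    using minus_mult_distrib_mat_vec[OF A mult_carrier_mat[OF L C] that]
      assoc_mult_mat_vec[OF L C that] by simp

  have Su_c: "S\<^sub>u \<in> carrier_mat n (m * n)" and Sy_c: "S\<^sub>y \<in> carrier_mat n (p * n)"
    unfolding Su Sy by (rule par_mat_carrier[OF M B], rule par_mat_carrier[OF M L])
  have S\<epsilon>\<eta>_c: "S\<^sub>\<epsilon>\<^sub>\<eta> \<in> carrier_mat n n" and S\<epsilon>x_c: "S\<^sub>\<epsilon>\<^sub>x \<in> carrier_mat n n"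
    unfolding S\<epsilon>\<eta>(1) S\<epsilon>x by (rule par_vec_carrier[OF A\<epsilon>(1) \<eta>\<epsilon>], rule par_vec_carrier[OF M \<epsilon>c])
  note inverse = invertible_mat_the_mat_inverse[OF S\<epsilon>\<eta>_c S\<epsilon>\<eta>(2)]
  have S\<epsilon>_c: "S\<^sub>\<epsilon> \<in> carrier_mat n n"
    unfolding S\<epsilon> by (rule mult_carrier_mat[OF S\<epsilon>x_c inverse(1)])
  have size: "m * n + p * n + n = (m + p + 1) * n" by (simp add: algebra_simps)
  have S_c: "S \<in> carrier_mat n ((m + p + 1) * n)"
    unfolding S size[symmetric] by (rule hconcat_triple_carrier[OF Su_c Sy_c S\<epsilon>_c])
  have \<eta>_append: "\<eta> t = (io_filters \<Lambda> m u t @\<^sub>v io_filters \<Lambda> p y t) @\<^sub>v \<eta>\<^sub>\<epsilon> t" for t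
    unfolding \<eta> by (simp add: append_vec_assoc)
  have \<eta>_c: "\<eta> t \<in> carrier_vec ((m + p + 1) * n)" for t
    unfolding \<eta>_append size[symmetric] by (intro append_carrier_vec fu fy \<eta>\<epsilon>)

  have observer: "z t = S\<^sub>u *\<^sub>v io_filters \<Lambda> m u' t + S\<^sub>y *\<^sub>v io_filters \<Lambda> p y' t"
    if "\<And>t. u' t \<in> carrier_vec m" "\<And>t. y' t \<in> carrier_vec p" "z 0 = 0\<^sub>v n"
      "\<And>t. z (Suc t) = ?M *\<^sub>v z t + B *\<^sub>v u' t + L *\<^sub>v y' t" for z u' y' t
    unfolding Su Sy \<Lambda> by (rule observer_state_eq[OF M B L n that])

  \<comment> \<open>The input term cancels in the difference, and L y = L C x turns A x into (A -
    LC) x.\<close>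
  have \<epsilon>_Suc: "\<epsilon> (Suc t) = ?M *\<^sub>v \<epsilon> t" for t
  proof -
    have "?M *\<^sub>v \<epsilon> t = ?M *\<^sub>v x t - ?M *\<^sub>v x\<^sub>c t"
      unfolding err by (rule mult_minus_distrib_mat_vec[OF M x xc])
    also have "\<dots> = \<epsilon> (Suc t)"
      unfolding err x_Suc xc_Suc M_mult[OF x] y using A B C L
      by (intro eq_vecI) (auto simp del: index_mult_mat_vec(1))
    finally show ?thesis ..
  qed
  have error: "\<epsilon> t = S\<^sub>\<epsilon> *\<^sub>v \<eta>\<^sub>\<epsilon> t" for t
  proof -
    let ?c = "((*\<^sub>v) (companion \<Lambda>) ^^ t) (unit_vec n (n - 1))"
    have "companion \<Lambda> \<in> carrier_mat n n" by (simp add: companion_def deg)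
    then have c: "?c \<in> carrier_vec n"
      by (induction t) (auto intro: mult_mat_vec_carrier)
    have "\<eta>\<^sub>\<epsilon> t = S\<^sub>\<epsilon>\<^sub>\<eta> *\<^sub>v ?c"
      using autonomous_state_eq[of A\<^sub>\<epsilon> n \<eta>\<^sub>\<epsilon> t, OF A\<epsilon>(1) n \<eta>\<epsilon> \<eta>\<epsilon>_Suc] by (simp add: S\<epsilon>\<eta>(1) char_poly_A\<epsilon>)
    then have "the (mat_inverse S\<^sub>\<epsilon>\<^sub>\<eta>) *\<^sub>v \<eta>\<^sub>\<epsilon> t = ?c"
      using assoc_mult_mat_vec[OF inverse(1) S\<epsilon>\<eta>_c c] c by (simp add: inverse(2))
    then have "S\<^sub>\<epsilon> *\<^sub>v \<eta>\<^sub>\<epsilon> t = S\<^sub>\<epsilon>\<^sub>x *\<^sub>v ?c"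
      unfolding S\<epsilon> using assoc_mult_mat_vec[OF S\<epsilon>x_c inverse(1) \<eta>\<epsilon>] by simp
    also have "\<dots> = \<epsilon> t"
      using autonomous_state_eq[of ?M n \<epsilon> t, OF M n \<epsilon>c \<epsilon>_Suc] by (simp add: S\<epsilon>x \<Lambda>)
    finally show ?thesis ..
  qed

  have state: "x t = S *\<^sub>v \<eta> t" for t
  proof -
    have "S *\<^sub>v \<eta> t = S\<^sub>u *\<^sub>v io_filters \<Lambda> m u t + (S\<^sub>y *\<^sub>v io_filters \<Lambda> p y t + S\<^sub>\<epsilon> *\<^sub>v \<eta>\<^sub>\<epsilon> t)"
      unfolding S \<eta> by (rule hconcat_triple_mult[OF Su_c Sy_c S\<epsilon>_c fu fy \<eta>\<epsilon>])
    also have "\<dots> = (S\<^sub>u *\<^sub>v io_filters \<Lambda> m u t + S\<^sub>y *\<^sub>v io_filters \<Lambda> p y t) + \<epsilon> t"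
      unfolding error using Su_c Sy_c S\<epsilon>_c fu fy \<eta>\<epsilon>
      by (intro assoc_add_vec[symmetric, where n = n] mult_mat_vec_carrier)
    also have "\<dots> = x\<^sub>c t + \<epsilon> t"
      using observer[of u y x\<^sub>c t, OF u yc xc_0 xc_Suc] by simp
    also have "\<dots> = x t"
      unfolding err using x[of t] xc[of t] by (intro eq_vecI) auto
    finally show ?thesis ..
  qed

  have step: "\<eta> (Suc t) = \<A>\<^sub>s *\<^sub>v \<eta> t + \<B>\<^sub>s *\<^sub>v vconcat [u t, y t, 0\<^sub>v 1]" for t
  proof -
    let ?w = "\<lambda>s. u s @\<^sub>v y s" and ?f = "io_filters \<Lambda> m u t @\<^sub>v io_filters \<Lambda> p y t"
    let ?K = "kron (1\<^sub>m (m + p)) A\<^sub>s" and ?N = "kron (1\<^sub>m (m + p)) (col_mat b\<^sub>s)"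
    have w: "?w s \<in> carrier_vec (m + p)" for s by (intro append_carrier_vec u yc)
    have As_c: "A\<^sub>s \<in> carrier_mat n n" by (simp add: As companion_def deg)
    have K: "?K \<in> carrier_mat ((m + p) * n) ((m + p) * n)"
      by (rule kron_carrier[OF one_carrier_mat As_c])
    have "col_mat b\<^sub>s \<in> carrier_mat n 1" by (rule col_mat_carrier) (simp add: bs)
    then have N: "?N \<in> carrier_mat ((m + p) * n) (m + p)"
      using kron_carrier[OF one_carrier_mat, of "col_mat b\<^sub>s" n 1 "m + p"] by simp
    have f: "?f \<in> carrier_vec ((m + p) * n)"
      using append_carrier_vec[OF fu fy] by (simp add: algebra_simps)
    \<comment> \<open>The trailing scalar 0 of the input meets the zero column of
      \<open>\<B>\<^sub>s\<close>, so the error block evolves without input.\<close>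
    have z: "0\<^sub>m n 1 *\<^sub>v 0\<^sub>v 1 = (0\<^sub>v n :: real vec)" by (intro eq_vecI) auto
    have "\<A>\<^sub>s *\<^sub>v \<eta> t = ?K *\<^sub>v ?f @\<^sub>v \<eta>\<^sub>\<epsilon> (Suc t)"
      unfolding AAs \<eta>_append \<eta>\<epsilon>_Suc by (rule diag_block_mat_pair_mult[OF K A\<epsilon>(1) f \<eta>\<epsilon>])
    moreover have "\<B>\<^sub>s *\<^sub>v vconcat [u t, y t, 0\<^sub>v 1] = ?N *\<^sub>v ?w t @\<^sub>v 0\<^sub>v n"
    proof -
      have "\<B>\<^sub>s *\<^sub>v (?w t @\<^sub>v 0\<^sub>v 1) = ?N *\<^sub>v ?w t @\<^sub>v 0\<^sub>m n 1 *\<^sub>v 0\<^sub>v 1"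
        unfolding BBs by (rule diag_block_mat_pair_mult[OF N zero_carrier_mat w zero_carrier_vec])
      then show ?thesis unfolding z by (simp add: append_vec_assoc)
    qed
    moreover have "(?K *\<^sub>v ?f @\<^sub>v \<eta>\<^sub>\<epsilon> (Suc t)) + (?N *\<^sub>v ?w t @\<^sub>v 0\<^sub>v n) =
        (?K *\<^sub>v ?f + ?N *\<^sub>v ?w t) @\<^sub>v (\<eta>\<^sub>\<epsilon> (Suc t) + 0\<^sub>v n)"
      by (rule append_vec_add[OF mult_mat_vec_carrier[OF K f] mult_mat_vec_carrier[OF N w] \<eta>\<epsilon>]) simp
    moreover have "?K *\<^sub>v ?f + ?N *\<^sub>v ?w t = io_filters \<Lambda> m u (Suc t) @\<^sub>v io_filters \<Lambda> p y (Suc t)"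
      using io_filters_Suc[of \<Lambda> ?w t, OF monic w]
      unfolding io_filters_append_vec[of u m y p, OF u yc] deg As bs by simp
    ultimately show ?thesis
      unfolding \<eta>_append[of "Suc t"] using \<eta>\<epsilon>[of "Suc t"] by simp
  qed

  have init: "\<eta> 0 = vconcat [0\<^sub>v ((m + p) * n), \<eta>\<^sub>\<epsilon> 0]"
  proof -
    have "io_filters \<Lambda> m u 0 @\<^sub>v io_filters \<Lambda> p y 0 = 0\<^sub>v ((m + p) * n)"
      unfolding io_filters_0[OF \<Lambda>0] deg by (intro eq_vecI) (auto simp: algebra_simps)
    then show ?thesis unfolding \<eta>_append by simp
  qed
  have "\<eta> 0 \<noteq> 0\<^sub>v ((m + p + 1) * n)"
  proof
    assume "\<eta> 0 = 0\<^sub>v ((m + p + 1) * n)"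
    also have "\<dots> = 0\<^sub>v ((m + p) * n) @\<^sub>v 0\<^sub>v n"
      by (intro eq_vecI) (auto simp: algebra_simps)
    finally have "0\<^sub>v ((m + p) * n) @\<^sub>v \<eta>\<^sub>\<epsilon> 0 = 0\<^sub>v ((m + p) * n) @\<^sub>v 0\<^sub>v n"
      by (simp add: init)
    then show False
      using \<eta>\<epsilon>_0 by (subst (asm) append_vec_eq[of _ "(m + p) * n"]) auto
  qed
  moreover have "full_row_rank S"
  proof (rule full_row_rankI[OF S_c])
    fix v :: "real vec" assume v: "v \<in> carrier_vec n"
    \<comment> \<open>A fresh input steering the origin to the arbitrary target v; it is unrelated
      to the given input u.\<close>
    obtain u' T where u': "\<And>t. u' t \<in> carrier_vec m" and T: "lti_state A B u' (0\<^sub>v n) T = v"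
      using AB v A B unfolding controllable_def by (metis carrier_matD zero_carrier_vec)
    let ?z = "lti_state A B u' (0\<^sub>v n)"
    let ?y = "\<lambda>t. C *\<^sub>v ?z t"
    \<comment> \<open>The preimage of v: the filter states of this trajectory at time T. Its error
      block is zero since plant and observer both start at the origin.\<close>
    let ?w = "vconcat [io_filters \<Lambda> m u' T, io_filters \<Lambda> p ?y T, 0\<^sub>v n]"
    have z: "?z t \<in> carrier_vec n" for t
      by (induction t) (auto intro!: add_carrier_vec
          mult_mat_vec_carrier[OF A] mult_mat_vec_carrier[OF B] u')
    \<comment> \<open>With the output C z fed back, L C z is subtracted and added again, so the
      plant trajectory solves the observer equation.\<close>
    have "?z (Suc t) = ?M *\<^sub>v ?z t + B *\<^sub>v u' t + L *\<^sub>v ?y t" for t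
      unfolding lti_state.simps M_mult[OF z] using A B C L
      by (intro eq_vecI) (auto simp del: index_mult_mat_vec(1))
    then have "v = S\<^sub>u *\<^sub>v io_filters \<Lambda> m u' T + S\<^sub>y *\<^sub>v io_filters \<Lambda> p ?y T"
      using observer[of u' ?y ?z T] u' C T by (auto intro: mult_mat_vec_carrier[OF C z])
    also have "\<dots> = S\<^sub>u *\<^sub>v io_filters \<Lambda> m u' T + (S\<^sub>y *\<^sub>v io_filters \<Lambda> p ?y T + S\<^sub>\<epsilon> *\<^sub>v 0\<^sub>v n)"
      using Su_c Sy_c S\<epsilon>_c by (intro eq_vecI) auto
    also have "\<dots> = S *\<^sub>v ?w"
      unfolding S by (rule hconcat_triple_mult[OF Su_c Sy_c S\<epsilon>_c fu fy zero_carrier_vec, symmetric])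
    finally have "S *\<^sub>v ?w = v" ..
    moreover have "?w \<in> carrier_vec (m * n + (p * n + (n + 0)))"
      unfolding vconcat_Cons vconcat_Nil by (intro append_carrier_vec fu fy zero_carrier_vec)
    then have "?w \<in> carrier_vec ((m + p + 1) * n)"
      by (simp add: algebra_simps)
    ultimately show "\<exists>w \<in> carrier_vec ((m + p + 1) * n). S *\<^sub>v w = v" by blast
  qed
  ultimately show ?thesis
    using \<eta>_c state step init S_c by blast
qed

end
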